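(* Let $(X,d)$ be a complete $CAT(0)$ space, let $K\subset X$ be nonempty, closed and convex, let $T:K\to K$ be nonexpansive with $\mathrm{Fix}(T)\neq\emptyset$, and let $f:K\to K$ be a $\beta$-contraction for some $\beta\in[0,1)$. Let $$\alpha_k:=\min\Big\{\frac{2}{(1-\beta)k},\,1\Big\},\qquad k\ge1,$$ let $x_0\in K$, and let $(x_k)_{k\ge0}$ be defined by $$x_{k+1}=\alpha_{k+1}f(x_k)\oplus(1-\alpha_{k+1})T(x_k),\qquad k\ge0.$$ Let $\bar x\in\mathrm{Fix}(T)$ and set $$C_{\bar x}:=\max\Big\{d(x_0,\bar x),\ \frac{1}{1-\beta}\,d(f(\bar x),\bar x)\Big\},\qquad J:=\Big\lceil\frac{2}{1-\beta}\Big\rceil .$$ Then the successive differences $d(x_k,x_{k-1})$ and the asymptotic regularity residuals $d(Tx_{k-1},x_{k-1})$ admit bounds of order $O(1/k)$; in particular, for all $k\ge1$, $$d(x_k,x_{k-1})\le\frac{2J\,C_{\bar x}}{(1-\beta)k}\qquad\text{and}\qquad d(Tx_{k-1},x_{k-1})\le\frac{2\,C_{\bar x}(J+2)}{(1-\beta)k}.$$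
   Context: A geodesic space $(X,d)$ is a metric space in which any two points $x,y$ are joined by a geodesic (an isometric image of the interval $[0,d(x,y)]$). It is a $CAT(0)$ space if for every geodesic triangle $\Delta$ in $X$ and all points $p,q\in\Delta$, $d(p,q)\le\|\bar p-\bar q\|$, where $\bar p,\bar q$ are the corresponding points of a comparison triangle (a triangle with the same side lengths) in the Euclidean plane. Every $CAT(0)$ space is uniquely geodesic. For $x,y\in X$ and $t\in[0,1]$, $(1-t)x\oplus ty$ denotes the unique point $z$ of the geodesic segment $[x,y]$ with $d(z,x)=t\,d(x,y)$ and $d(z,y)=(1-t)\,d(x,y)$. A set $K\subset X$ is convex if $[x,y]\subset K$ for all $x,y\in K$. A map $T:K\to K$ is nonexpansive if $d(Tx,Ty)\le d(x,y)$ for all $x,y\in K$; $f:K\to K$ is a $\beta$-contraction if $d(f(x),f(y))\le\beta\,d(x,y)$ for all $x,y\in K$. $\mathrm{Fix}(T)=\{x\in K: Tx=x\}$. *)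

theory Defs
  imports "HOL-Analysis.Analysis" "HOL-Library.Landau_Symbols"
begin

context Metric_space
begin

definition geodesic :: "'a \<Rightarrow> 'a \<Rightarrow> (real \<Rightarrow> 'a) \<Rightarrow> bool" where
  "geodesic x y c \<longleftrightarrow>
     c ` {0..d x y} \<subseteq> M \<and> c 0 = x \<and> c (d x y) = y \<and>
     (\<forall>s\<in>{0..d x y}. \<forall>t\<in>{0..d x y}. d (c s) (c t) = \<bar>s - t\<bar>)"

definition geodesic_segment :: "'a \<Rightarrow> 'a \<Rightarrow> 'a set \<Rightarrow> bool" where
  "geodesic_segment x y S \<longleftrightarrow> (\<exists>c. geodesic x y c \<and> S = c ` {0..d x y})"

definition geodesic_triangle ::
    "'a \<Rightarrow> 'a \<Rightarrow> 'a \<Rightarrow> 'a set \<Rightarrow> 'a set \<Rightarrow> 'a set \<Rightarrow> bool" where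
  "geodesic_triangle x y z Sxy Syz Szx \<longleftrightarrow>
     x \<in> M \<and> y \<in> M \<and> z \<in> M \<and>
     geodesic_segment x y Sxy \<and> geodesic_segment y z Syz \<and> geodesic_segment z x Szx"

definition comparison_triangle ::
    "'a \<Rightarrow> 'a \<Rightarrow> 'a \<Rightarrow> real ^ 2 \<Rightarrow> real ^ 2 \<Rightarrow> real ^ 2 \<Rightarrow> bool" where
  "comparison_triangle x y z x' y' z' \<longleftrightarrow>
     dist x' y' = d x y \<and> dist y' z' = d y z \<and> dist z' x' = d z x"

definition comparison_point_on_side ::
    "'a \<Rightarrow> 'a set \<Rightarrow> real ^ 2 \<Rightarrow> real ^ 2 \<Rightarrow> 'a \<Rightarrow> real ^ 2 \<Rightarrow> bool" where
  "comparison_point_on_side x S x' y' p p' \<longleftrightarrow>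
     p \<in> S \<and> p' \<in> closed_segment x' y' \<and> dist x' p' = d x p"

text \<open>A point lying on several sides of a triangle may have several comparison points,
  one for each side; the CAT(0) inequality is required for all of them.\<close>

definition comparison_point ::
    "'a \<Rightarrow> 'a \<Rightarrow> 'a \<Rightarrow> 'a set \<Rightarrow> 'a set \<Rightarrow> 'a set \<Rightarrow>
     real ^ 2 \<Rightarrow> real ^ 2 \<Rightarrow> real ^ 2 \<Rightarrow> 'a \<Rightarrow> real ^ 2 \<Rightarrow> bool" where
  "comparison_point x y z Sxy Syz Szx x' y' z' p p' \<longleftrightarrow>
     comparison_point_on_side x Sxy x' y' p p' \<or>
     comparison_point_on_side y Syz y' z' p p' \<or>
     comparison_point_on_side z Szx z' x' p p'"

text \<open>\<open>geodesic_comb t x y\<close> is the point $(1-t)x \oplus ty$: the weight \<open>t\<close> belongs to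
  the second point \<open>y\<close>.\<close>

definition geodesic_comb :: "real \<Rightarrow> 'a \<Rightarrow> 'a \<Rightarrow> 'a" where
  "geodesic_comb t x y =
     (THE z. \<exists>S. geodesic_segment x y S \<and> z \<in> S \<and>
        d z x = t * d x y \<and> d z y = (1 - t) * d x y)"

definition geodesically_convex :: "'a set \<Rightarrow> bool" where
  "geodesically_convex K \<longleftrightarrow>
     K \<subseteq> M \<and> (\<forall>x\<in>K. \<forall>y\<in>K. \<forall>S. geodesic_segment x y S \<longrightarrow> S \<subseteq> K)"

definition nonexpansive_on :: "'a set \<Rightarrow> ('a \<Rightarrow> 'a) \<Rightarrow> bool" where
  "nonexpansive_on K T \<longleftrightarrow> T \<in> K \<rightarrow> K \<and> (\<forall>x\<in>K. \<forall>y\<in>K. d (T x) (T y) \<le> d x y)"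

definition contraction_on :: "real \<Rightarrow> 'a set \<Rightarrow> ('a \<Rightarrow> 'a) \<Rightarrow> bool" where
  "contraction_on \<beta> K f \<longleftrightarrow> f \<in> K \<rightarrow> K \<and> (\<forall>x\<in>K. \<forall>y\<in>K. d (f x) (f y) \<le> \<beta> * d x y)"

end

locale geodesic_space = Metric_space +
  assumes ex_geodesic: "\<lbrakk>x \<in> M; y \<in> M\<rbrakk> \<Longrightarrow> \<exists>c. geodesic x y c"

locale CAT0_space = geodesic_space +
  assumes CAT0_inequality:
    "\<lbrakk>geodesic_triangle x y z Sxy Syz Szx; comparison_triangle x y z x' y' z';
      comparison_point x y z Sxy Syz Szx x' y' z' p p';
      comparison_point x y z Sxy Syz Szx x' y' z' q q'\<rbrakk>
     \<Longrightarrow> d p q \<le> dist p' q'"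

definition Fix :: "'a set \<Rightarrow> ('a \<Rightarrow> 'a) \<Rightarrow> 'a set" where
  "Fix K T = {x \<in> K. T x = x}"

lemma (in Metric_space) geodesic_segment_sym:
  assumes "geodesic_segment x y S"
  shows "geodesic_segment y x S"
proof -
  obtain c where c: "geodesic x y c" and S: "S = c ` {0..d x y}"
    using assms by (auto simp: geodesic_segment_def)
  let ?c = "\<lambda>t. c (d x y - t)"
  have im: "(\<lambda>t. d x y - t) ` {0..d x y} = {0..d x y}"
    by (auto simp: image_iff intro!: bexI[where x = "d x y - t" for t])
  have "?c ` {0..d x y} = S"
    unfolding S by (metis im image_image)
  moreover have "geodesic y x ?c"
    using c \<open>?c ` {0..d x y} = S\<close> S by (auto simp: geodesic_def commute)
  ultimately show ?thesis
    by (auto simp: geodesic_segment_def commute)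
qed

text \<open>The description in \<open>geodesic_comb\<close> determines a unique point.\<close>

lemma (in CAT0_space) geodesic_comb_ex1:
  assumes x: "x \<in> M" and y: "y \<in> M" and t: "0 \<le> t" "t \<le> 1"
  shows "\<exists>!z. \<exists>S. geodesic_segment x y S \<and> z \<in> S \<and>
    d z x = t * d x y \<and> d z y = (1 - t) * d x y"
proof (rule ex_ex1I)
  obtain c where c: "geodesic x y c"
    using ex_geodesic x y by blast
  have l: "0 \<le> t * d x y" "t * d x y \<le> d x y"
    using t by (auto simp: mult_left_le_one_le)
  have iso: "d (c s) (c r) = \<bar>s - r\<bar>" if "s \<in> {0..d x y}" "r \<in> {0..d x y}" for s r
    using c that unfolding geodesic_def by blast
  have ends: "c 0 = x" "c (d x y) = y"
    using c unfolding geodesic_def by auto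
  have "d (c (t * d x y)) x = t * d x y" "d (c (t * d x y)) y = (1 - t) * d x y"
    using iso[of "t * d x y" 0] iso[of "t * d x y" "d x y"] l ends by (auto simp: algebra_simps)
  then show "\<exists>z S. geodesic_segment x y S \<and> z \<in> S \<and>
      d z x = t * d x y \<and> d z y = (1 - t) * d x y"
    using c l by (intro exI[of _ "c (t * d x y)"] exI[of _ "c ` {0..d x y}"])
      (auto simp: geodesic_segment_def)
next
  fix p q
  assume "\<exists>S. geodesic_segment x y S \<and> p \<in> S \<and> d p x = t * d x y \<and> d p y = (1 - t) * d x y"
    and "\<exists>S. geodesic_segment x y S \<and> q \<in> S \<and> d q x = t * d x y \<and> d q y = (1 - t) * d x y"
  then obtain S S' where S: "geodesic_segment x y S" "p \<in> S" "d p x = t * d x y"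
    and S': "geodesic_segment x y S'" "q \<in> S'" "d q y = (1 - t) * d x y"
    by blast
  define x' y' :: "real ^ 2" where "x' = 0" and "y' = d x y *\<^sub>R axis 1 1"
  let ?p = "(1 - t) *\<^sub>R x' + t *\<^sub>R y'"
  have dx: "dist x' y' = d x y" "dist x' ?p = t * d x y"
    using t by (auto simp: x'_def y'_def)
  have "y' - ?p = (1 - t) *\<^sub>R y'"
    by (simp add: x'_def algebra_simps)
  then have dy: "dist y' ?p = (1 - t) * d x y"
    using t by (simp add: dist_norm y'_def)
  have seg: "?p \<in> closed_segment x' y'" "?p \<in> closed_segment y' x'"
    using t by (auto simp: closed_segment_def intro: exI[of _ t] exI[of _ "1 - t"])
  have "geodesic y y (\<lambda>_. y)"
    using y by (auto simp: geodesic_def)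
  then have "geodesic_triangle x y y S ((\<lambda>_. y) ` {0..d y y}) S'"
    using x y S S' geodesic_segment_sym
    by (auto simp: geodesic_triangle_def geodesic_segment_def)
  moreover have "comparison_triangle x y y x' y' y'"
    using dx y by (simp add: comparison_triangle_def commute dist_commute)
  moreover have "comparison_point x y y S ((\<lambda>_. y) ` {0..d y y}) S' x' y' y' p ?p"
    using S dx seg by (simp add: comparison_point_def comparison_point_on_side_def commute)
  moreover have "comparison_point x y y S ((\<lambda>_. y) ` {0..d y y}) S' x' y' y' q ?p"
    using S' dy seg by (simp add: comparison_point_def comparison_point_on_side_def commute)
  ultimately have "d p q \<le> dist ?p ?p"
    by (rule CAT0_inequality)
  moreover have "p \<in> M" "q \<in> M"
    using S S' by (auto simp: geodesic_segment_def geodesic_def)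
  ultimately show "p = q"
    by (metis dist_self nonneg order_antisym zero)
qed

end

theory Submission
  imports Defs
begin

text \<open>
  All iterates lie in the ball of radius \<open>C\<close> around \<open>xbar\<close>.
  Since $d(\alpha u \oplus (1-\alpha) v, \alpha u' \oplus (1-\alpha) v')
  \le \alpha d(u,u') + (1-\alpha) d(v,v')$ in a CAT(0) space, the differences
  $D_k = d(x_k, x_{k-1})$ satisfy
  $D_{k+1} \le (1 - (1-\beta)\alpha_{k+1}) D_k + 2C |\alpha_{k+1} - \alpha_k|$.
  For $k \le J$ the trivial bound $D_k \le 2C$ suffices; for $k \ge J$ the minimum in
  $\alpha_k$ is attained by the first argument, the recursion becomes
  $D_{k+1} \le \frac{k-1}{k+1} D_k + \frac{4C}{(1-\beta)k(k+1)}$, and it preserves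
  $D_k \le 2JC/((1-\beta)k)$ because $J \ge 2$.
\<close>

section \<open>Euclidean comparison triangles\<close>

text \<open>Place \<open>x\<close> at the origin and \<open>y\<close> on the first axis; the apex
  \<open>z\<close> is then determined up to reflection. The CAT(0) inequality says something about a
  triangle only once such a planar triangle is at hand.\<close>

lemma comparison_triangle_exists_real:
  fixes a b c :: real
  assumes nonneg: "0 \<le> a" "0 \<le> b" "0 \<le> c"
    and tri: "a \<le> b + c" "b \<le> a + c" "c \<le> a + b"
  shows "\<exists>x y z :: real ^ 2. dist x y = a \<and> dist y z = b \<and> dist z x = c"
proof -
  have norm2: "norm v = sqrt ((v $ 1)\<^sup>2 + (v $ 2)\<^sup>2)" for v :: "real ^ 2"
    by (simp add: norm_vec_def L2_set_def sum_2)
  show ?thesis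
  proof (cases "a = 0")
    case True
    then have "b = c"
      using tri by simp
    then show ?thesis
      using True nonneg
      by (intro exI[of _ 0] exI[of _ "c *\<^sub>R axis 1 1"]) (simp add: dist_norm)
  next
    case False
    then have a: "a > 0"
      using nonneg by simp
    \<comment> \<open>The law of cosines forces this first coordinate of \<open>z\<close>.\<close>
    define u where "u = (a\<^sup>2 + c\<^sup>2 - b\<^sup>2) / (2 * a)"
    have u: "2 * a * u = a\<^sup>2 + c\<^sup>2 - b\<^sup>2"
      using a by (simp add: u_def)
    \<comment> \<open>Heron's factorization: both sides are 16 times the squared area. The triangle
      inequalities make the factors nonnegative, so the second coordinate
      \<open>sqrt (c\<^sup>2 - u\<^sup>2)\<close> of \<open>z\<close> is the root of a nonnegative
      number.\<close>
    have "(2 * a * c)\<^sup>2 - (2 * a * u)\<^sup>2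
        = ((a + b + c) * (a + c - b)) * ((a + b - c) * (b + c - a))"
      unfolding u by algebra
    also have "\<dots> \<ge> 0"
      using nonneg tri by simp
    finally have "(2 * a)\<^sup>2 * u\<^sup>2 \<le> (2 * a)\<^sup>2 * c\<^sup>2"
      by (simp add: power_mult_distrib)
    then have uc: "u\<^sup>2 \<le> c\<^sup>2"
      using a by simp
    define z :: "real ^ 2" where "z = vector [u, sqrt (c\<^sup>2 - u\<^sup>2)]"
    define y :: "real ^ 2" where "y = vector [a, 0]"
    have "dist 0 y = a" "dist z 0 = c"
      using uc nonneg by (simp_all add: norm2 y_def z_def)
    moreover have "(a - u)\<^sup>2 + (c\<^sup>2 - u\<^sup>2) = b\<^sup>2"
      using u by (simp add: power2_diff)
    then have "dist y z = b"
      using uc nonneg by (simp add: dist_norm norm2 y_def z_def)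
    ultimately show ?thesis
      by blast
  qed
qed

context Metric_space
begin

lemma comparison_triangle_exists:
  assumes "x \<in> M" "y \<in> M" "z \<in> M"
  shows "\<exists>x' y' z'. comparison_triangle x y z x' y' z'"
  unfolding comparison_triangle_def
  using assms triangle[of x z y] triangle[of y x z] triangle[of z y x]
  by (intro comparison_triangle_exists_real) (simp_all add: commute)

end

section \<open>Convex combinations along geodesics\<close>

context CAT0_space
begin

lemma geodesic_comb_props:
  assumes "x \<in> M" "y \<in> M" "0 \<le> t" "t \<le> 1"
  obtains S where "geodesic_segment x y S" "geodesic_comb t x y \<in> S"
    "d (geodesic_comb t x y) x = t * d x y" "d (geodesic_comb t x y) y = (1 - t) * d x y"
  using theI'[OF geodesic_comb_ex1[OF assms]] unfolding geodesic_comb_def[symmetric] by blast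

lemma geodesic_comb_eqI:
  assumes "x \<in> M" "y \<in> M" "0 \<le> t" "t \<le> 1"
    and "geodesic_segment x y S" "z \<in> S" "d z x = t * d x y" "d z y = (1 - t) * d x y"
  shows "geodesic_comb t x y = z"
  unfolding geodesic_comb_def
  by (rule the1_equality[OF geodesic_comb_ex1]) (use assms in blast)+

lemma geodesic_comb_in_convex:
  assumes "geodesically_convex K" "x \<in> K" "y \<in> K" "0 \<le> t" "t \<le> 1"
  shows "geodesic_comb t x y \<in> K"
proof -
  have "x \<in> M" "y \<in> M"
    using assms by (auto simp: geodesically_convex_def)
  then obtain S where "geodesic_segment x y S" "geodesic_comb t x y \<in> S"
    using geodesic_comb_props assms by blast
  then show ?thesis
    using assms unfolding geodesically_convex_def by blast
qed

lemma geodesic_comb_in [simp]: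
  assumes "x \<in> M" "y \<in> M" "0 \<le> t" "t \<le> 1"
  shows "geodesic_comb t x y \<in> M"
proof -
  have "geodesically_convex M"
    by (auto simp: geodesically_convex_def geodesic_segment_def geodesic_def)
  then show ?thesis
    using assms by (rule geodesic_comb_in_convex)
qed

lemma geodesic_comb_swap:
  assumes "x \<in> M" "y \<in> M" "0 \<le> t" "t \<le> 1"
  shows "geodesic_comb t x y = geodesic_comb (1 - t) y x"
proof -
  obtain S where "geodesic_segment y x S" "geodesic_comb (1 - t) y x \<in> S"
    "d (geodesic_comb (1 - t) y x) y = (1 - t) * d y x"
    "d (geodesic_comb (1 - t) y x) x = (1 - (1 - t)) * d y x"
    by (rule geodesic_comb_props[of y x "1 - t"]) (use assms in auto)
  then show ?thesis
    using assms by (intro geodesic_comb_eqI) (auto simp: geodesic_segment_sym commute)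
qed

lemma geodesic_comb_same:
  assumes "x \<in> M" "0 \<le> t" "t \<le> 1"
  shows "geodesic_comb t x x = x"
proof -
  have "d (geodesic_comb t x x) x = 0"
    by (rule geodesic_comb_props[of x x t]) (use assms in auto)
  then show ?thesis
    using assms by simp
qed

text \<open>By uniqueness of the combination, both points lie on one and the same geodesic, which is
  an isometry of an interval.\<close>

lemma dist_geodesic_comb_weights:
  assumes "x \<in> M" "y \<in> M" "0 \<le> t" "t \<le> 1" "0 \<le> s" "s \<le> 1"
  shows "d (geodesic_comb t x y) (geodesic_comb s x y) = \<bar>t - s\<bar> * d x y"
proof -
  obtain c where c: "geodesic x y c"
    using ex_geodesic assms by blast
  have iso: "d (c r) (c q) = \<bar>r - q\<bar>" if "r \<in> {0..d x y}" "q \<in> {0..d x y}" for r q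
    using c that unfolding geodesic_def by blast
  have range: "r * d x y \<in> {0..d x y}" if "0 \<le> r" "r \<le> 1" for r
    using that by (auto simp: mult_left_le_one_le)
  have comb: "geodesic_comb r x y = c (r * d x y)" if r: "0 \<le> r" "r \<le> 1" for r
  proof (rule geodesic_comb_eqI)
    show "geodesic_segment x y (c ` {0..d x y})"
      using c by (auto simp: geodesic_segment_def)
    have "c 0 = x" "c (d x y) = y"
      using c by (auto simp: geodesic_def)
    then show "d (c (r * d x y)) x = r * d x y" "d (c (r * d x y)) y = (1 - r) * d x y"
      using iso[of "r * d x y" 0] iso[of "r * d x y" "d x y"] range[OF r] r
      by (auto simp: algebra_simps)
  qed (use assms r range in auto)
  have "d (geodesic_comb t x y) (geodesic_comb s x y) = \<bar>(t - s) * d x y\<bar>"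
    using assms range by (simp only: comb iso left_diff_distrib)
  then show ?thesis
    by (simp add: abs_mult)
qed

text \<open>In the plane, two sides issuing from \<open>x'\<close> and cut at the same ratio
  \<open>t\<close> give exactly \<open>t\<close> times the opposite side; the CAT(0) inequality
  carries this over as an upper bound.\<close>

lemma dist_geodesic_comb_common_left:
  assumes M: "x \<in> M" "y \<in> M" "z \<in> M" and t: "0 \<le> t" "t \<le> 1"
  shows "d (geodesic_comb t x y) (geodesic_comb t x z) \<le> t * d y z"
proof -
  obtain x' y' z' where tri: "comparison_triangle x y z x' y' z'"
    using comparison_triangle_exists M by blast
  obtain S1 where S1: "geodesic_segment x y S1" "geodesic_comb t x y \<in> S1"
    "d (geodesic_comb t x y) x = t * d x y"
    using geodesic_comb_props M t by metis
  \<comment> \<open>The third side of the triangle runs from \<open>z\<close> to \<open>x\<close>,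
    so the comparison point on it is located by its distance from \<open>z\<close>.\<close>
  obtain S2 where S2: "geodesic_segment x z S2" "geodesic_comb t x z \<in> S2"
    "d (geodesic_comb t x z) z = (1 - t) * d x z"
    using geodesic_comb_props M t by metis
  obtain S3 where S3: "geodesic_segment y z S3"
    using ex_geodesic M unfolding geodesic_segment_def by blast
  define p q where "p = (1 - t) *\<^sub>R x' + t *\<^sub>R y'" and "q = (1 - t) *\<^sub>R x' + t *\<^sub>R z'"
  have "x' - p = t *\<^sub>R (x' - y')" "z' - q = (1 - t) *\<^sub>R (z' - x')" "p - q = t *\<^sub>R (y' - z')"
    by (simp_all add: p_def q_def algebra_simps)
  then have dists: "dist x' p = t * d x y" "dist z' q = (1 - t) * d z x" "dist p q = t * d y z"
    using t tri by (simp_all add: dist_norm comparison_triangle_def)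
  have "p \<in> closed_segment x' y'" "q \<in> closed_segment x' z'"
    using t by (auto simp: p_def q_def closed_segment_def)
  then have seg: "p \<in> closed_segment x' y'" "q \<in> closed_segment z' x'"
    by (simp_all add: closed_segment_commute)
  have "geodesic_triangle x y z S1 S3 S2"
    using M S1 S2 S3 by (simp add: geodesic_triangle_def geodesic_segment_sym)
  moreover note tri
  moreover have "comparison_point x y z S1 S3 S2 x' y' z' (geodesic_comb t x y) p"
    using S1 dists seg by (simp add: comparison_point_def comparison_point_on_side_def commute)
  moreover have "comparison_point x y z S1 S3 S2 x' y' z' (geodesic_comb t x z) q"
    using S2 dists seg by (simp add: comparison_point_def comparison_point_on_side_def commute)
  ultimately have "d (geodesic_comb t x y) (geodesic_comb t x z) \<le> dist p q"
    by (rule CAT0_inequality)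
  then show ?thesis
    by (simp add: dists)
qed

text \<open>Pass through the combination of \<open>x\<close> and \<open>y'\<close>: the two
  resulting pairs of segments share the endpoint \<open>x\<close> and the endpoint \<open>y'\<close>
  respectively.\<close>

lemma dist_geodesic_comb:
  assumes M: "x \<in> M" "y \<in> M" "x' \<in> M" "y' \<in> M" and t: "0 \<le> t" "t \<le> 1"
  shows "d (geodesic_comb t x y) (geodesic_comb t x' y') \<le> (1 - t) * d x x' + t * d y y'"
proof -
  have "d (geodesic_comb t x y) (geodesic_comb t x' y')
      \<le> d (geodesic_comb t x y) (geodesic_comb t x y')
        + d (geodesic_comb t x y') (geodesic_comb t x' y')"
    using M t by (intro triangle) auto
  moreover have "d (geodesic_comb t x y) (geodesic_comb t x y') \<le> t * d y y'"
    using M t by (intro dist_geodesic_comb_common_left)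
  moreover have "d (geodesic_comb t x y') (geodesic_comb t x' y') \<le> (1 - t) * d x x'"
    using dist_geodesic_comb_common_left[of y' x x' "1 - t"] M t
    by (simp add: geodesic_comb_swap[of _ y'])
  ultimately show ?thesis
    by linarith
qed

lemma dist_geodesic_comb_point:
  assumes "x \<in> M" "y \<in> M" "z \<in> M" "0 \<le> t" "t \<le> 1"
  shows "d (geodesic_comb t x y) z \<le> (1 - t) * d x z + t * d y z"
  using dist_geodesic_comb[of x y z z t] assms by (simp add: geodesic_comb_same)

end

section \<open>A recursive inequality for real sequences\<close>

text \<open>Once \<open>2 * c\<close> is enlarged to \<open>J * c\<close>, the bound reproduces
  itself exactly: its factor is
  \<open>(k - 1) / (k + 1) + 1 / (k + 1) = k / (k + 1)\<close>.\<close>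

lemma harmonic_recursion_bound:
  fixes D :: "nat \<Rightarrow> real" and c :: real
  assumes init: "\<And>k. 1 \<le> k \<Longrightarrow> k \<le> J \<Longrightarrow> D k \<le> c * real J / real k"
    and J: "2 \<le> J" and c: "0 \<le> c"
    and step: "\<And>k. J \<le> k \<Longrightarrow>
      D (Suc k) \<le> (1 - 2 / real (Suc k)) * D k + 2 * c * (1 / real k - 1 / real (Suc k))"
    and "1 \<le> k"
  shows "D k \<le> c * real J / real k"
  using \<open>1 \<le> k\<close>
proof (induction k rule: dec_induct)
  case base
  then show ?case
    using init[of 1] J by simp
next
  case (step k)
  show ?case
  proof (cases "Suc k \<le> J")
    case True
    then show ?thesis
      using init[of "Suc k"] by simp
  next
    case False
    then have k: "J \<le> k"
      by simp
    have "D (Suc k) \<le> (1 - 2 / real (Suc k)) * D k + 2 * c * (1 / real k - 1 / real (Suc k))"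
      using assms(4) k by blast
    also have "\<dots> \<le> (1 - 2 / real (Suc k)) * (c * real J / real k)
        + real J * c * (1 / real k - 1 / real (Suc k))"
      using step J c k
      by (intro add_mono mult_left_mono mult_right_mono) (auto simp: field_simps)
    also have "\<dots> = c * real J / real (Suc k)"
      using k J by (simp add: divide_simps) (simp add: algebra_simps)
    finally show ?thesis .
  qed
qed

section \<open>Rates for the iteration\<close>

theorem theorem4p11:
  fixes X :: "'a set" and d :: "'a \<Rightarrow> 'a \<Rightarrow> real"
    and K :: "'a set" and T f :: "'a \<Rightarrow> 'a"
    and \<beta> C :: real and \<alpha> :: "nat \<Rightarrow> real" and x :: "nat \<Rightarrow> 'a" and xbar :: 'a and J :: int
  assumes "CAT0_space X d" and "Metric_space.mcomplete X d"
    and "K \<noteq> {}" and "closedin (Metric_space.mtopology X d) K"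
    and "Metric_space.geodesically_convex X d K"
    and "Metric_space.nonexpansive_on d K T" and "Fix K T \<noteq> {}"
    and "0 \<le> \<beta>" and "\<beta> < 1" and "Metric_space.contraction_on d \<beta> K f"
    and "\<And>k. k \<ge> 1 \<Longrightarrow> \<alpha> k = min (2 / ((1 - \<beta>) * real k)) 1"
    and "x 0 \<in> K"
    and "\<And>k. x (Suc k) =
           Metric_space.geodesic_comb X d (1 - \<alpha> (Suc k)) (f (x k)) (T (x k))"
    and "xbar \<in> Fix K T"
    and "C = max (d (x 0) xbar) (1 / (1 - \<beta>) * d (f xbar) xbar)"
    and "J = \<lceil>2 / (1 - \<beta>)\<rceil>"
  shows "(\<lambda>k. d (x k) (x (k - 1))) \<in> O(\<lambda>k. 1 / real k) \<and>
    (\<lambda>k. d (T (x (k - 1))) (x (k - 1))) \<in> O(\<lambda>k. 1 / real k) \<and>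
    (\<forall>k\<ge>1. d (x k) (x (k - 1)) \<le> 2 * of_int J * C / ((1 - \<beta>) * real k) \<and>
      d (T (x (k - 1))) (x (k - 1)) \<le> 2 * C * (of_int J + 2) / ((1 - \<beta>) * real k))"
proof -
  interpret CAT0_space X d
    by fact
  note \<alpha>_eq = assms(11) and x_Suc = assms(13)
  have KM: "u \<in> X" if "u \<in> K" for u
    using that \<open>geodesically_convex K\<close> by (auto simp: geodesically_convex_def)
  have TK: "T u \<in> K" and fK: "f u \<in> K" if "u \<in> K" for u
    using that assms(6,10) by (auto simp: nonexpansive_on_def contraction_on_def)
  have Td: "d (T u) (T v) \<le> d u v" and fd: "d (f u) (f v) \<le> \<beta> * d u v"
    if "u \<in> K" "v \<in> K" for u v
    using that assms(6,10) by (auto simp: nonexpansive_on_def contraction_on_def)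
  have xbar: "xbar \<in> K" "T xbar = xbar"
    using assms(14) by (auto simp: Fix_def)
  have \<alpha>: "0 \<le> \<alpha> k" "\<alpha> k \<le> 1" "\<alpha> k \<le> 2 / ((1 - \<beta>) * real k)" if "1 \<le> k" for k
    using \<alpha>_eq[OF that] \<open>\<beta> < 1\<close> by auto
  have xK: "x k \<in> K" for k
  proof (induction k)
    case (Suc k)
    then show ?case
      unfolding x_Suc using \<alpha>[of "Suc k"] assms(5)
      by (intro geodesic_comb_in_convex) (auto simp: TK fK)
  qed fact
  note mem = KM xK TK fK xbar(1)
  have C0: "0 \<le> C" and C1: "d (f xbar) xbar \<le> (1 - \<beta>) * C"
    using assms(15) \<open>\<beta> < 1\<close> by (auto simp: le_max_iff_disj field_simps max_def)
  have Tball: "d (T u) xbar \<le> C" and fball: "d (f u) xbar \<le> C"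
    if "u \<in> K" "d u xbar \<le> C" for u
  proof -
    show "d (T u) xbar \<le> C"
      using Td[of u xbar] that xbar by simp
    \<comment> \<open>The second entry of the maximum \<open>C\<close> bounds the displacement of
      \<open>xbar\<close> under \<open>f\<close> by just what the contraction gains.\<close>
    have "d (f u) xbar \<le> d (f u) (f xbar) + d (f xbar) xbar"
      using that by (intro triangle mem)
    also have "\<dots> \<le> \<beta> * C + (1 - \<beta>) * C"
      using fd[of u xbar] C1 mult_left_mono[OF that(2) \<open>0 \<le> \<beta>\<close>] that xbar by linarith
    finally show "d (f u) xbar \<le> C"
      by (simp add: algebra_simps)
  qed
  have xball: "d (x k) xbar \<le> C" for k
  proof (induction k)
    case 0
    then show ?case
      using assms(15) by simp
  next
    case (Suc k)
    have "d (x (Suc k)) xbar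
        \<le> \<alpha> (Suc k) * d (f (x k)) xbar + (1 - \<alpha> (Suc k)) * d (T (x k)) xbar"
      using dist_geodesic_comb_point[of "f (x k)" "T (x k)" xbar "1 - \<alpha> (Suc k)"]
        \<alpha>[of "Suc k"] mem by (simp add: x_Suc)
    also have "\<dots> \<le> \<alpha> (Suc k) * C + (1 - \<alpha> (Suc k)) * C"
      using \<alpha>[of "Suc k"] Suc Tball fball xK by (intro add_mono mult_left_mono) auto
    finally show ?case
      by (simp add: algebra_simps)
  qed
  have diam: "d u v \<le> 2 * C" if "u \<in> K" "v \<in> K" "d u xbar \<le> C" "d v xbar \<le> C" for u v
    using triangle[of u xbar v] that mem by (simp add: commute)
  have fT: "d (f (x k)) (T (x k)) \<le> 2 * C" for k
    using Tball fball xball mem by (intro diam) auto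

  have rec: "d (x (Suc k)) (x k)
      \<le> (1 - (1 - \<beta>) * \<alpha> (Suc k)) * d (x k) (x (k - 1)) + 2 * C * \<bar>\<alpha> (Suc k) - \<alpha> k\<bar>"
    if k: "1 \<le> k" for k
  proof -
    obtain m where m: "k = Suc m"
      using k by (cases k) auto
    let ?a = "\<alpha> (Suc k)"
    \<comment> \<open>The old points combined with the new weight: this separates the change of the
      points from the change of the weight.\<close>
    let ?y = "geodesic_comb (1 - ?a) (f (x m)) (T (x m))"
    have a: "0 \<le> ?a" "?a \<le> 1" and a': "0 \<le> \<alpha> k" "\<alpha> k \<le> 1"
      using \<alpha> k by auto
    have "?y \<in> X"
      using a mem by (intro geodesic_comb_in) auto
    then have "d (x (Suc k)) (x k) \<le> d (x (Suc k)) ?y + d ?y (x k)"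
      by (intro triangle) (simp_all add: mem)
    moreover have "d (x (Suc k)) ?y
        \<le> ?a * d (f (x k)) (f (x m)) + (1 - ?a) * d (T (x k)) (T (x m))"
      using dist_geodesic_comb[of "f (x k)" "T (x k)" "f (x m)" "T (x m)" "1 - ?a"] a mem
      by (simp add: x_Suc[of k])
    moreover have "\<dots> \<le> ?a * (\<beta> * d (x k) (x m)) + (1 - ?a) * d (x k) (x m)"
      using a fd Td xK by (intro add_mono mult_left_mono) auto
    moreover have "d ?y (x k) \<le> \<bar>?a - \<alpha> k\<bar> * (2 * C)"
    proof -
      have "d ?y (x k) = \<bar>?a - \<alpha> k\<bar> * d (f (x m)) (T (x m))"
        using dist_geodesic_comb_weights[of "f (x m)" "T (x m)" "1 - ?a" "1 - \<alpha> k"] a a' mem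
        by (simp add: m x_Suc[of m] abs_minus_commute)
      then show ?thesis
        using fT by (simp add: mult_left_mono)
    qed
    ultimately show ?thesis
      by (simp add: m algebra_simps)
  qed

  have J: "2 / (1 - \<beta>) \<le> of_int J"
    using assms(16) by linarith
  have "2 \<le> 2 / (1 - \<beta>)"
    using assms(8,9) by (simp add: field_simps)
  then have J2: "2 \<le> J"
    using J by linarith
  define N where "N = nat J"
  have N: "real N = of_int J" "2 \<le> N"
    using J2 by (simp_all add: N_def)
  \<comment> \<open>With this constant the weight term of \<open>rec\<close> takes the form
    \<open>2 * c * (1 / k - 1 / (k + 1))\<close> for \<open>k\<close> at least \<open>N\<close>, and
    \<open>c\<close> still dominates the diameter bound \<open>2 * C\<close>.\<close>
  define c where "c = 2 * C / (1 - \<beta>)"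
  have c: "2 * C \<le> c" "0 \<le> c"
    using C0 assms(8,9) by (auto simp: c_def field_simps)
  have \<alpha>_large: "\<alpha> k = 2 / ((1 - \<beta>) * real k)" if "N \<le> k" for k
  proof -
    have "2 / (1 - \<beta>) \<le> real k"
      using J N that by linarith
    then show ?thesis
      using \<alpha>_eq[of k] N that \<open>\<beta> < 1\<close> by (auto simp: min_def field_simps)
  qed
  have diff: "d (x k) (x (k - 1)) \<le> c * real N / real k" if "1 \<le> k" for k
  proof (rule harmonic_recursion_bound[OF _ \<open>2 \<le> N\<close> \<open>0 \<le> c\<close> _ that])
    fix k assume k: "1 \<le> k" "k \<le> N"
    have "d (x k) (x (k - 1)) \<le> c"
      using diam[of "x k" "x (k - 1)"] xK xball c by fastforce
    also have "\<dots> \<le> c * real N / real k"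
      using k c by (simp add: field_simps mult_left_mono)
    finally show "d (x k) (x (k - 1)) \<le> c * real N / real k" .
  next
    fix k assume k: "N \<le> k"
    have \<alpha>_Suc: "(1 - \<beta>) * \<alpha> (Suc k) = 2 / real (Suc k)"
      using \<alpha>_large[of "Suc k"] k \<open>\<beta> < 1\<close> by (simp del: of_nat_Suc left_diff_distrib_numeral)
    have "\<alpha> k - \<alpha> (Suc k) = 2 / (1 - \<beta>) * (1 / real k - 1 / real (Suc k))"
      using \<alpha>_large[of "Suc k"] \<alpha>_large[of k] k by (simp add: right_diff_distrib)
    moreover have "0 \<le> 2 / (1 - \<beta>) * (1 / real k - 1 / real (Suc k))"
      using k N \<open>\<beta> < 1\<close> by (intro mult_nonneg_nonneg) (auto simp: field_simps)
    \<comment> \<open>The weights decrease from \<open>N\<close> on, which resolves the absolute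
      value.\<close>
    ultimately have "\<bar>\<alpha> (Suc k) - \<alpha> k\<bar> = 2 / (1 - \<beta>) * (1 / real k - 1 / real (Suc k))"
      by linarith
    then have "2 * C * \<bar>\<alpha> (Suc k) - \<alpha> k\<bar> = 2 * c * (1 / real k - 1 / real (Suc k))"
      by (simp add: c_def)
    then show "d (x (Suc k)) (x (Suc k - 1)) \<le> (1 - 2 / real (Suc k)) * d (x k) (x (k - 1))
        + 2 * c * (1 / real k - 1 / real (Suc k))"
      using rec[of k] k N \<alpha>_Suc by simp
  qed
  have res: "d (T (x (k - 1))) (x (k - 1)) \<le> c * (real N + 2) / real k" if k: "1 \<le> k" for k
  proof -
    obtain m where m: "k = Suc m"
      using k by (cases k) auto
    \<comment> \<open>The iterate \<open>x k\<close> divides the segment from \<open>f (x m)\<close>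
      to \<open>T (x m)\<close>, so its distance to \<open>T (x m)\<close> is at most
      \<open>2 * c / k\<close>. This is the summand 2 in \<open>N + 2\<close>; the rest is the
      successive difference.\<close>
    have "d (x k) (T (x m)) = \<alpha> k * d (f (x m)) (T (x m))"
      using geodesic_comb_props[of "f (x m)" "T (x m)" "1 - \<alpha> k"] \<alpha>[OF k] mem
      by (simp add: m x_Suc)
    also have "\<dots> \<le> 2 / ((1 - \<beta>) * real k) * (2 * C)"
      using \<alpha>[OF k] fT C0 \<open>\<beta> < 1\<close> by (intro mult_mono) auto
    also have "\<dots> = c * 2 / real k"
      by (simp add: c_def)
    finally have "d (x k) (T (x m)) \<le> c * 2 / real k" .
    moreover have "d (T (x m)) (x m) \<le> d (T (x m)) (x k) + d (x k) (x m)"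
      by (intro triangle mem)
    ultimately show ?thesis
      using diff[OF k] by (simp add: m commute distrib_left add_divide_distrib)
  qed
  \<comment> \<open>The explicit bounds supply the constants; starting at 1 avoids
    \<open>k = 0\<close>, where \<open>1 / real k\<close> is 0.\<close>
  have "(\<lambda>k. d (x k) (x (k - 1))) \<in> O(\<lambda>k. 1 / real k)"
    using diff by (intro bigoI[of _ "c * real N"] eventually_sequentiallyI[of 1]) simp
  moreover have "(\<lambda>k. d (T (x (k - 1))) (x (k - 1))) \<in> O(\<lambda>k. 1 / real k)"
    using res by (intro bigoI[of _ "c * (real N + 2)"] eventually_sequentiallyI[of 1]) simp
  ultimately show ?thesis
    using diff res by (simp add: c_def N mult_ac)
qed

end
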